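(* Let $N>1$ and let $X_0\in\mathcal X$. Suppose that $G_0\,\varphi(r)>E_0:=\Psi(X_0)$. Let $X(t)=(X^1(t),\dots,X^N(t))$, $t\ge 0$, be any trajectory of the gradient flow $$\frac{dX^i(t)}{dt}=-(\nabla\Psi(X(t)))_i,\qquad i=1,\dots,N,$$ with initial position $X(0)=X_0$. Then for all $t>0$ $$\inf_{i,\,j\neq i}\|X^i(t)-X^j(t)\|^2>r^2 .$$
   Context: $N$ robots have positions $X=(X^1,\dots,X^N)$ with $X^i\in\mathbb R^2$; $\|\cdot\|$ is the Euclidean norm on $\mathbb R^2$; $(\nabla\Psi(X))_i\in\mathbb R^2$ is the gradient of $\Psi$ with respect to $X^i$. Constants: $0<r<R$, $G_0>0$, $M>0$, and $\Omega=[-M,M]^2$. The set of admissible configurations is $$\mathcal X=\{(X^1,\dots,X^N): X^i\in\Omega \text{ for all } i,\ \inf_{i,\,j\ne i}\|X^i-X^j\|>r\}.$$ The potential is $\Psi=F+G$, where: - $F:(\mathbb R^2)^N\to[0,\infty)$ is differentiable, bounded on $\Omega^N$, and attains its minimum only at configurations in the desired target region. - $G$ is the repelling function $$G(X)=G_0\sum_{i=1}^N\sum_{\substack{j\neq i\\ \|X^i-X^j\|<R}}\varphi(\|X^i-X^j\|),$$ where $\varphi\in C^1(0,\infty)$ is a decreasing function with $\lim_{x\to R^-}\varphi(x)=\lim_{x\to R^-}\varphi'(x)=0$. Pairs at distance at least $R$ contribute $0$. The function $G$, and hence $\Psi$ and the gradient flow, is defined on configurations with pairwise distinct points. A trajectory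 is a differentiable curve on $[0,\infty)$ with values in such configurations that satisfies the differential equation. *)

theory Defs
  imports "HOL-Analysis.Analysis"
begin

text \<open>The robots are indexed by a finite type \<open>'n\<close>, so that \<open>N = CARD('n)\<close>.\<close>

type_synonym 'n config = "(real ^ 2) ^ 'n"

definition square_region :: "real \<Rightarrow> (real ^ 2) set" where
  "square_region M = {x. \<forall>k. x $ k \<in> {-M..M}}"

definition distinct_pairs :: "('n \<times> 'n) set" where
  "distinct_pairs = {(i, j). j \<noteq> i}"

definition admissible :: "real \<Rightarrow> real \<Rightarrow> ('n::finite) config set" where
  "admissible M r =
     {X. (\<forall>i. X $ i \<in> square_region M) \<and>
         (INF (i, j)\<in>distinct_pairs. norm (X $ i - X $ j)) > r}"

definition pairwise_distinct :: "('n::finite) config set" where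
  "pairwise_distinct = {X. \<forall>i j. j \<noteq> i \<longrightarrow> X $ i \<noteq> X $ j}"

definition repulsion :: "real \<Rightarrow> real \<Rightarrow> (real \<Rightarrow> real) \<Rightarrow> ('n::finite) config \<Rightarrow> real" where
  "repulsion G0 R \<phi> X =
     G0 * (\<Sum>i\<in>UNIV. \<Sum>j\<in>{j. j \<noteq> i \<and> norm (X $ i - X $ j) < R}. \<phi> (norm (X $ i - X $ j)))"

definition potential ::
  "(('n::finite) config \<Rightarrow> real) \<Rightarrow> real \<Rightarrow> real \<Rightarrow> (real \<Rightarrow> real) \<Rightarrow> 'n config \<Rightarrow> real" where
  "potential F G0 R \<phi> X = F X + repulsion G0 R \<phi> X"

definition attains_min_only_in :: "('a \<Rightarrow> real) \<Rightarrow> 'a set \<Rightarrow> bool" where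
  "attains_min_only_in F T \<longleftrightarrow>
     (\<exists>X. \<forall>Y. F X \<le> F Y) \<and> (\<forall>X. (\<forall>Y. F X \<le> F Y) \<longrightarrow> X \<in> T)"

text \<open>
  The gradient with respect to \<open>X\<^sup>i\<close>: only the \<open>i\<close>-th point moves. The value is meaningful
  when \<open>\<Psi>\<close> is differentiable at \<open>X\<close> in the variable \<open>X\<^sup>i\<close>, see \<open>partial_gradient_eqI\<close>.
\<close>

definition partial_gradient ::
  "(('n::finite) config \<Rightarrow> real) \<Rightarrow> 'n config \<Rightarrow> 'n \<Rightarrow> real ^ 2" where
  "partial_gradient \<Psi> X i =
     (THE g. GDERIV (\<lambda>y. \<Psi> (\<chi> k. if k = i then y else X $ k)) (X $ i) :> g)"

lemma partial_gradient_eqI: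
  assumes "GDERIV (\<lambda>y. \<Psi> (\<chi> k. if k = i then y else X $ k)) (X $ i) :> g"
  shows "partial_gradient \<Psi> X i = g"
  unfolding partial_gradient_def
proof (rule the_equality)
  show "GDERIV (\<lambda>y. \<Psi> (\<chi> k. if k = i then y else X $ k)) (X $ i) :> g"
    by (fact assms)
next
  fix h assume "GDERIV (\<lambda>y. \<Psi> (\<chi> k. if k = i then y else X $ k)) (X $ i) :> h"
  then have "(\<lambda>v. v \<bullet> h) = (\<lambda>v. v \<bullet> g)"
    using assms unfolding gderiv_def by (rule has_derivative_unique)
  then show "h = g"
    by (metis vector_eq_ldot)
qed

text \<open>
  The values of \<open>\<Psi>\<close> at configurations with coinciding points carry no meaning, so trajectories
  are required to avoid them. At time \<open>0\<close> the derivative is one-sided.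
\<close>

definition gradient_flow_trajectory ::
  "(('n::finite) config \<Rightarrow> real) \<Rightarrow> (real \<Rightarrow> 'n config) \<Rightarrow> bool" where
  "gradient_flow_trajectory \<Psi> X \<longleftrightarrow>
     (\<forall>t\<ge>0. X t \<in> pairwise_distinct \<and>
       (\<forall>i. ((\<lambda>s. X s $ i) has_vector_derivative - partial_gradient \<Psi> (X t) i)
              (at t within {0..})))"

end

theory Submission
  imports Defs
begin

text \<open>
  Truncating \<open>\<phi>\<close> at \<open>R\<close> leaves a nonnegative function that is differentiable on the positive
  reals, because \<open>\<phi>\<close> and \<open>\<phi>'\<close> both vanish at \<open>R\<close>. Hence \<open>\<Psi>\<close> is differentiable at configurations
  with distinct points and decreases along the flow, with derivative minus the squared norm of
  its gradient. A pair at distance at most \<open>r\<close> would alone contribute at least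
  \<open>G\<^sub>0 \<phi>(r) > \<Psi>(X\<^sub>0)\<close> to \<open>\<Psi>\<close>, all other contributions being nonnegative.
\<close>

text \<open>Away from \<open>R\<close> the truncation agrees locally with \<open>f\<close> or with
  0. At \<open>R\<close> its difference quotient is bounded in norm by that of \<open>f\<close>,
  which tends to 0.\<close>

lemma truncation_differentiable:
  fixes f :: "real \<Rightarrow> real"
  assumes f: "f differentiable (at x)"
    and deriv_R: "(f has_real_derivative 0) (at R)" and "f R = 0"
  shows "(\<lambda>x. if x < R then f x else 0) differentiable (at x)"
proof -
  let ?g = "\<lambda>x. if x < R then f x else 0"
  consider "x < R" | "x = R" | "R < x" by linarith
  then show ?thesis
  proof cases
    case 1
    from f obtain D where "(f has_derivative D) (at x)"
      by (auto simp: differentiable_def)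
    then have "(?g has_derivative D) (at x)"
      by (rule has_derivative_transform_within_open[where s = "{..<R}"]) (use 1 in auto)
    then show ?thesis by (auto simp: differentiable_def)
  next
    case 2
    have "((\<lambda>y. (f y - f R) / (y - R)) \<longlongrightarrow> 0) (at R)"
      using deriv_R by (simp add: has_field_derivative_iff)
    then have "((\<lambda>y. norm ((f y - f R) / (y - R))) \<longlongrightarrow> 0) (at R)"
      by (rule tendsto_norm_zero)
    then have "((\<lambda>y. (?g y - ?g R) / (y - R)) \<longlongrightarrow> 0) (at R)"
      by (rule Lim_null_comparison[rotated]) (simp add: \<open>f R = 0\<close>)
    then have "(?g has_real_derivative 0) (at R)"
      by (simp add: has_field_derivative_iff)
    then show ?thesis
      using 2 real_differentiable_def by blast
  next
    case 3
    have "((\<lambda>_. 0 :: real) has_derivative (\<lambda>_. 0)) (at x)"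
      by simp
    then have "(?g has_derivative (\<lambda>_. 0)) (at x)"
      by (rule has_derivative_transform_within_open[where s = "{R<..}"]) (use 3 in auto)
    then show ?thesis by (auto simp: differentiable_def)
  qed
qed

text \<open>Turns the one-sided limits assumed of \<phi> into facts at \<open>R\<close> itself:
  \<open>R\<close> is interior to the domain, so continuity of \<open>f\<close> and of its
  derivative identifies the left limits with the values.\<close>

lemma C1_vanishing_at_left:
  fixes f :: "real \<Rightarrow> real"
  assumes "f C1_differentiable_on S" "open S" "R \<in> S"
    and "(f \<longlongrightarrow> 0) (at_left R)" "(deriv f \<longlongrightarrow> 0) (at_left R)"
  shows "f R = 0" "(f has_real_derivative 0) (at R)"
proof -
  obtain D where D: "\<And>x. x \<in> S \<Longrightarrow> (f has_vector_derivative D x) (at x)"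
    and cont: "continuous_on S D"
    using assms(1) unfolding C1_differentiable_on_def by blast
  have D': "(f has_real_derivative D x) (at x)" if "x \<in> S" for x
    using D[OF that] by (simp add: has_real_derivative_iff_has_vector_derivative)
  have "isCont f R"
    using D'[OF \<open>R \<in> S\<close>] by (rule DERIV_isCont)
  then have "(f \<longlongrightarrow> f R) (at_left R)"
    by (auto simp: isCont_def intro: tendsto_within_subset)
  then show "f R = 0"
    using assms(4) by (intro tendsto_unique[of "at_left R"]) auto
  have "isCont D R"
    using cont assms(2,3) continuous_on_eq_continuous_at by blast
  then have "(D \<longlongrightarrow> D R) (at_left R)"
    by (auto simp: isCont_def intro: tendsto_within_subset)
  moreover have "eventually (\<lambda>x. x \<in> S) (at_left R)"
    using assms(2,3) unfolding eventually_at_topological by blast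
  \<comment> \<open>The limit is assumed for \<open>deriv f\<close>, the continuity known for
    \<open>D\<close>. They agree on \<open>S\<close>, which contains a left neighbourhood of
    \<open>R\<close>.\<close>
  then have "eventually (\<lambda>x. deriv f x = D x) (at_left R)"
    by eventually_elim (rule DERIV_imp_deriv[OF D'])
  ultimately have "(deriv f \<longlongrightarrow> D R) (at_left R)"
    by (simp cong: tendsto_cong)
  then have "D R = 0"
    using assms(5) by (intro tendsto_unique[of "at_left R"]) auto
  then show "(f has_real_derivative 0) (at R)"
    using D'[OF \<open>R \<in> S\<close>] by simp
qed

text \<open>In \<open>repulsion\<close> the inner index set varies with \<open>X\<close>. Moving the
  cutoff into the summand fixes it, so that the sum can be differentiated term by term.\<close>

lemma repulsion_eq_truncation:
  "repulsion G0 R \<phi> X =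
     G0 * (\<Sum>i\<in>UNIV. \<Sum>j\<in>- {i}. (\<lambda>x. if x < R then \<phi> x else 0) (norm (X $ i - X $ j)))"
proof -
  have "(\<Sum>j\<in>{j. j \<noteq> i \<and> norm (X $ i - X $ j) < R}. \<phi> (norm (X $ i - X $ j))) =
        (\<Sum>j\<in>- {i}. if norm (X $ i - X $ j) < R then \<phi> (norm (X $ i - X $ j)) else 0)" for i
    by (rule sum.mono_neutral_cong_left) auto
  then show ?thesis by (simp add: repulsion_def)
qed

lemma repulsion_differentiable:
  fixes X :: "('n::finite) config"
  assumes X: "X \<in> pairwise_distinct"
    and \<phi>: "\<And>x. 0 < x \<Longrightarrow> (\<lambda>x. if x < R then \<phi> x else 0) differentiable (at x)"
  shows "repulsion G0 R \<phi> differentiable (at X)"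
proof -
  let ?g = "\<lambda>x. if x < R then \<phi> x else 0"
  have pair: "(\<lambda>Y :: 'n config. ?g (norm (Y $ i - Y $ j))) differentiable (at X)"
    if "j \<in> - {i}" for i j
  proof -
    \<comment> \<open>Distinctness enters here: the norm is differentiable away from 0, and the
      truncation at positive arguments.\<close>
    have ne: "X $ i - X $ j \<noteq> 0"
      using X that by (auto simp: pairwise_distinct_def)
    have "(\<lambda>Y :: 'n config. Y $ i - Y $ j) differentiable (at X)"
      by (intro linear_imp_differentiable) (auto simp: linear_iff algebra_simps)
    then have "(norm \<circ> (\<lambda>Y :: 'n config. Y $ i - Y $ j)) differentiable (at X)"
      using ne by (rule differentiable_chain_at[OF _ differentiable_norm_at])
    then have "(?g \<circ> (norm \<circ> (\<lambda>Y :: 'n config. Y $ i - Y $ j))) differentiable (at X)"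
      by (rule differentiable_chain_at[OF _ \<phi>]) (use ne in simp)
    then show ?thesis by (simp add: o_def)
  qed
  show ?thesis
    unfolding repulsion_eq_truncation
    by (intro differentiable_mult differentiable_const differentiable_sum ballI pair finite)
qed

text \<open>Each partial gradient represents, through the inner product, the restriction of
  \<open>D\<close> to the \<open>i\<close>-th block. Splitting \<open>v\<close> into its blocks and
  using linearity gives the sum.\<close>

lemma has_derivative_partial_gradient:
  fixes \<Psi> :: "('n::finite) config \<Rightarrow> real"
  assumes D: "(\<Psi> has_derivative D) (at X)"
  shows "D v = (\<Sum>i\<in>UNIV. partial_gradient \<Psi> X i \<bullet> v $ i)"
proof -
  interpret D: linear D
    using D by (rule has_derivative_linear)
  have "partial_gradient \<Psi> X i \<bullet> w = D (axis i w)" for i w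
  proof -
    let ?e = "\<lambda>y. \<chi> k. if k = i then y else X $ k"
    \<comment> \<open>Moving only the \<open>i\<close>-th point is an affine map, with linear part
      \<open>axis i\<close>.\<close>
    have e: "?e y = X + axis i (y - X $ i)" for y
      by (simp add: vec_eq_iff axis_def)
    have lin: "bounded_linear (axis i :: real ^ 2 \<Rightarrow> 'n config)"
      by (intro linear_conv_bounded_linear[THEN iffD1]) (auto simp: linear_iff vec_eq_iff axis_def)
    have "(?e has_derivative axis i) (at (X $ i))"
      unfolding e by (auto intro!: derivative_eq_intros bounded_linear.has_derivative[OF lin])
    moreover have "(\<Psi> has_derivative D) (at (?e (X $ i)))"
      using D by (simp add: e axis_def vec_eq_iff flip: zero_vec_def)
    ultimately have "((\<lambda>y. \<Psi> (?e y)) has_derivative (\<lambda>w. D (axis i w))) (at (X $ i))"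
      by (rule has_derivative_compose)
    moreover
    \<comment> \<open>The adjoint of a linear functional, applied to 1, is the vector representing
      that functional.\<close>
    define g where "g = adjoint (\<lambda>w. D (axis i w)) 1"
    have "linear (\<lambda>w. D (axis i w))"
      using linear_compose[OF bounded_linear.linear[OF lin] D.linear_axioms] by (simp add: o_def)
    then have g: "w \<bullet> g = D (axis i w)" for w
      using adjoint_works[of "\<lambda>w. D (axis i w)" w 1] by (simp add: g_def)
    ultimately have "GDERIV (\<lambda>y. \<Psi> (?e y)) (X $ i) :> g"
      by (simp add: gderiv_def)
    then show ?thesis
      using g[of w] by (simp add: partial_gradient_eqI inner_commute)
  qed
  moreover have "v = (\<Sum>i\<in>UNIV. axis i (v $ i))"
    by (simp add: vec_eq_iff axis_def)
  then have "D v = D (\<Sum>i\<in>UNIV. axis i (v $ i))"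
    by (rule arg_cong)
  then have "D v = (\<Sum>i\<in>UNIV. D (axis i (v $ i)))"
    unfolding D.sum .
  ultimately show ?thesis by simp
qed

lemma has_vector_derivative_vec:
  fixes f :: "real \<Rightarrow> ('a::real_normed_vector) ^ ('n::finite)"
  assumes "\<And>i. ((\<lambda>s. f s $ i) has_vector_derivative v $ i) F"
  shows "(f has_vector_derivative v) F"
  using assms unfolding has_vector_derivative_def has_derivative_def
  by (auto intro!: vec_tendstoI bounded_linear_scaleR_left)

lemma gradient_flow_decreasing:
  fixes \<Psi> :: "('n::finite) config \<Rightarrow> real"
  assumes traj: "gradient_flow_trajectory \<Psi> X"
    and diff: "\<And>Y. Y \<in> pairwise_distinct \<Longrightarrow> \<Psi> differentiable (at Y)"
    and "0 \<le> s" "s \<le> t"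
  shows "\<Psi> (X t) \<le> \<Psi> (X s)"
proof -
  have deriv: "((\<lambda>s. \<Psi> (X s)) has_real_derivative
      - (\<Sum>i\<in>UNIV. (norm (partial_gradient \<Psi> (X u) i))\<^sup>2)) (at u within {0..})"
    if "0 \<le> u" for u
  proof -
    let ?v = "\<chi> i. - partial_gradient \<Psi> (X u) i"
    obtain D where D: "(\<Psi> has_derivative D) (at (X u))"
      using traj diff \<open>0 \<le> u\<close> unfolding gradient_flow_trajectory_def differentiable_def by blast
    have "(X has_vector_derivative ?v) (at u within {0..})"
    proof (rule has_vector_derivative_vec)
      show "((\<lambda>s. X s $ i) has_vector_derivative ?v $ i) (at u within {0..})" for i
        unfolding vec_lambda_beta
        using traj \<open>0 \<le> u\<close> unfolding gradient_flow_trajectory_def by blast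
    qed
    then have "((\<Psi> \<circ> X) has_vector_derivative D ?v) (at u within {0..})"
      using has_derivative_at_withinI[OF D] by (rule vector_derivative_diff_chain_within)
    moreover have "D ?v = - (\<Sum>i\<in>UNIV. (norm (partial_gradient \<Psi> (X u) i))\<^sup>2)"
      by (simp add: has_derivative_partial_gradient[OF D] sum_negf power2_norm_eq_inner)
    ultimately show ?thesis
      by (simp add: has_real_derivative_iff_has_vector_derivative o_def)
  qed
  show ?thesis
  proof (cases "s = t")
    case False
    \<comment> \<open>Times after \<open>s\<close> are positive, so the derivative within
      \<open>{0..}\<close> is two-sided there. At \<open>s\<close> itself, possibly 0, continuity
      suffices for the monotonicity criterion.\<close>
    have "\<exists>y. ((\<lambda>s. \<Psi> (X s)) has_real_derivative y) (at u) \<and> y \<le> 0" if "s < u" for u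
    proof -
      have "u \<in> interior {0..}"
        using that \<open>0 \<le> s\<close> by simp
      then have "at u within {0..} = at u"
        by (rule at_within_interior)
      then show ?thesis
        using deriv[of u] that \<open>0 \<le> s\<close>
        by (intro exI[of _ "- (\<Sum>i\<in>UNIV. (norm (partial_gradient \<Psi> (X u) i))\<^sup>2)"])
          (simp add: sum_nonneg)
    qed
    moreover have "continuous_on {s..t} (\<lambda>s. \<Psi> (X s))"
      using \<open>0 \<le> s\<close> deriv
      by (intro continuous_on_subset[OF DERIV_continuous_on[of "{0..}"]]) auto
    ultimately show ?thesis
      using \<open>s \<le> t\<close> False by (intro DERIV_nonpos_imp_decreasing_open[of s t]) auto
  qed simp
qed

theorem theorem6p1:
  fixes r R G0 M :: real
    and F :: "('n::finite) config \<Rightarrow> real"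
    and T :: "'n config set"
    and \<phi> :: "real \<Rightarrow> real"
    and X0 :: "'n config"
    and X :: "real \<Rightarrow> 'n config"
  assumes N: "CARD('n) > 1"
    and "0 < r" "r < R" "G0 > 0" "M > 0"
    and F_nonneg: "\<And>Y. F Y \<ge> 0"
    and F_differentiable: "F differentiable_on UNIV"
    and F_bounded: "bounded (F ` {Y. \<forall>i. Y $ i \<in> square_region M})"
    and F_min: "attains_min_only_in F T"
    and phi_C1: "\<phi> C1_differentiable_on {0<..}"
    and phi_decreasing: "antimono_on {0<..} \<phi>"
    and phi_lim: "(\<phi> \<longlongrightarrow> 0) (at_left R)"
    and phi_deriv_lim: "(deriv \<phi> \<longlongrightarrow> 0) (at_left R)"
    and X0: "X0 \<in> admissible M r"
    and energy: "G0 * \<phi> r > potential F G0 R \<phi> X0"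
    and trajectory: "gradient_flow_trajectory (potential F G0 R \<phi>) X"
    and initial: "X 0 = X0"
  shows "\<forall>t>0. (INF (i, j)\<in>distinct_pairs. (norm (X t $ i - X t $ j))\<^sup>2) > r\<^sup>2"
proof (intro allI impI)
  fix t :: real assume "t > 0"
  let ?g = "\<lambda>x. if x < R then \<phi> x else 0"
  let ?\<Psi> = "potential F G0 R \<phi>"
  have "0 < R" using \<open>0 < r\<close> \<open>r < R\<close> by simp
  note phi_R = C1_vanishing_at_left[OF phi_C1 open_greaterThan _ phi_lim phi_deriv_lim,
      unfolded greaterThan_iff, OF \<open>0 < R\<close>]
  have phi_diff: "\<phi> differentiable (at x)" if "0 < x" for x
    using phi_C1 that
    by (auto simp: C1_differentiable_on_def has_vector_derivative_def differentiable_def)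
  have anti: "\<phi> y \<le> \<phi> x" if "0 < x" "x \<le> y" for x y
    using phi_decreasing that by (auto simp: monotone_on_def)
  \<comment> \<open>A decreasing \<phi> with \<phi>(R) = 0 is nonnegative up to
    \<open>R\<close>.\<close>
  have g_nonneg: "0 \<le> ?g x" if "0 < x" for x
    using anti[OF that, of R] phi_R(1) by simp
  have Psi_diff: "?\<Psi> differentiable (at Y)" if "Y \<in> pairwise_distinct" for Y
  proof -
    have "F differentiable (at Y)"
      using F_differentiable by (simp add: differentiable_on_def)
    moreover have "repulsion G0 R \<phi> differentiable (at Y)"
      using that by (intro repulsion_differentiable truncation_differentiable phi_diff phi_R)
    ultimately show ?thesis
      unfolding potential_def[abs_def] by (rule differentiable_add)
  qed
  have "?\<Psi> (X t) \<le> ?\<Psi> (X 0)"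
    using \<open>t > 0\<close> by (intro gradient_flow_decreasing[OF trajectory Psi_diff]) auto
  then have below: "?\<Psi> (X t) < G0 * \<phi> r"
    using energy initial by simp
  have pos: "0 < norm (X t $ i - X t $ j)" if "j \<noteq> i" for i j
    using trajectory \<open>t > 0\<close> that
    by (auto simp: gradient_flow_trajectory_def pairwise_distinct_def)
  have pair_nonneg: "0 \<le> ?g (norm (X t $ i - X t $ j))" if "j \<noteq> i" for i j
    by (rule g_nonneg[OF pos[OF that]])
  \<comment> \<open>The energy bound at the single time \<open>t\<close> excludes a close pair, so
    no first exit time has to be considered. One ordered pair already gives the contradiction,
    although the double sum counts each pair twice.\<close>
  have "r < norm (X t $ i - X t $ j)" if "j \<noteq> i" for i j
  proof (rule ccontr)
    assume "\<not> r < norm (X t $ i - X t $ j)"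
    \<comment> \<open>A pair at distance at most \<open>r < R\<close> lies inside the cutoff, where
      the truncation is \<phi>.\<close>
    then have "\<phi> r \<le> ?g (norm (X t $ i - X t $ j))"
      using pos[OF that] anti \<open>r < R\<close> by simp
    also have "\<dots> \<le> (\<Sum>j\<in>- {i}. ?g (norm (X t $ i - X t $ j)))"
    proof (rule member_le_sum[of j "- {i}" "\<lambda>j. ?g (norm (X t $ i - X t $ j))"])
      show "0 \<le> ?g (norm (X t $ i - X t $ k))" if "k \<in> - {i} - {j}" for k
        using that by (intro pair_nonneg) simp
    qed (use that in simp_all)
    also have "\<dots> \<le> (\<Sum>i\<in>UNIV. \<Sum>j\<in>- {i}. ?g (norm (X t $ i - X t $ j)))"
    proof (rule member_le_sum[of i UNIV "\<lambda>i. \<Sum>j\<in>- {i}. ?g (norm (X t $ i - X t $ j))"])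
      show "0 \<le> (\<Sum>j\<in>- {k}. ?g (norm (X t $ k - X t $ j)))" for k
        by (intro sum_nonneg pair_nonneg) simp
    qed simp_all
    finally have "G0 * \<phi> r \<le> repulsion G0 R \<phi> (X t)"
      using \<open>G0 > 0\<close> by (simp add: repulsion_eq_truncation)
    then show False
      using below F_nonneg[of "X t"] by (simp add: potential_def)
  qed
  then have sq: "r\<^sup>2 < (norm (X t $ i - X t $ j))\<^sup>2" if "j \<noteq> i" for i j
    using that \<open>0 < r\<close> by (intro power_strict_mono) auto
  obtain a b :: 'n where "a \<noteq> b"
    using N card_le_Suc0_iff_eq[of "UNIV :: 'n set"] by auto
  then have "(distinct_pairs :: ('n \<times> 'n) set) \<noteq> {}"
    by (auto simp: distinct_pairs_def)
  \<comment> \<open>The strict bound survives the infimum because it ranges over a finite nonempty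
    set and is attained.\<close>
  then show "(INF (i, j)\<in>distinct_pairs. (norm (X t $ i - X t $ j))\<^sup>2) > r\<^sup>2"
    using sq by (subst finite_less_Inf_iff) (auto simp: distinct_pairs_def)
qed

end
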